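(* Let $0<\mu\le L$, let $\kappa=L/\mu$, and let $d\ge1$. For every integer $p\ge1$ there exists a $p$-SCLI optimization algorithm $\mathcal{A}$ over $\mathbb{R}^d$, consistent with respect to $\mathcal{Q}^d([\mu,L])$, whose inversion matrix is scalar (i.e. $N(X)=\nu I_d$ for a fixed $\nu\in\mathbb{R}$) and such that for every $f_{A,\mathbf{b}}\in\mathcal{Q}^d([\mu,L])$ and all initialization points $\mathcal{X}^0\in\mathbb{R}^{dp}$, $$\mathcal{IC}_{\mathcal{A}}\left(\epsilon,f_{A,\mathbf{b}},\mathcal{X}^0\right)=\tilde{\mathcal{O}}\left(\sqrt[p]{\kappa}\,\ln(1/\epsilon)\right).$$
   Context: For $\Sigma\subseteq(0,\infty)$ nonempty, $\mathcal{S}^d(\Sigma)$ is the set of real symmetric $d\times d$ matrices with all eigenvalues in $\Sigma$, and $\mathcal{Q}^d(\Sigma)$ is the set of functions $f_{A,\mathbf{b}}(\mathbf{x})=\frac12\mathbf{x}^\top A\mathbf{x}+\mathbf{b}^\top\mathbf{x}$ with $A\in\mathcal{S}^d(\Sigma)$, $\mathbf{b}\in\mathbb{R}^d$; the minimizer of $f_{A,\mathbf{b}}$ is $\mathbf{x}^*=-A^{-1}\mathbf{b}$. A $p$-SCLI optimization algorithm $\mathcal{A}$ over $\mathbb{R}^d$ is given by $p+1$ mappings $C_0(X),\dots,C_{p-1}(X)$ (coefficient matrices) and $N(X)$ (inversion matrix) from $\mathbb{R}^{d\times d}$ to $\mathbb{R}^{d\times d}$-valued random variables (possibly deterministic). Applied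 to $f_{A,\mathbf{b}}$ with initialization points $\mathcal{X}^0=(\mathbf{x}^0,\dots,\mathbf{x}^{p-1})\in(\mathbb{R}^{d})^p$ it generates $$\mathbf{x}^k=\sum_{j=0}^{p-1}C_j(A)\mathbf{x}^{k-p+j}+N(A)\mathbf{b},\qquad k=p,p+1,\dots,$$ where in each iteration the tuple $(C_0(A),\dots,C_{p-1}(A),N(A))$ is drawn afresh from the same law, independently of all previous realizations. The expectations $\mathbb{E}C_j(A)$ and $\mathbb{E}N(A)$ are assumed finite, and $\mathbb{E}C_0(A),\dots,\mathbb{E}C_{p-1}(A)$ are assumed simultaneously triangularizable by a real invertible matrix. No restriction is imposed on how $C_j(A)$ depends on $A$. $\mathcal{A}$ is consistent with respect to $A\in\mathcal{S}^d(\Sigma)$ if for every $\mathbf{b}\in\mathbb{R}^d$ and all initialization points $\mathbb{E}\mathbf{x}^k\to-A^{-1}\mathbf{b}$; it is consistent with respect to $\mathcal{Q}^d(\Sigma)$ if it is consistent with respect to every $A\in\mathcal{S}^d(\Sigma)$. The iteration complexity $\mathcal{IC}_{\mathcal{A}}(\epsilon,f_{A,\mathbf{b}},\mathcal{X}^0)$ is the minimal $K$ such that $\|\mathbb{E}[\mathbf{x}^k-\mathbf{x}^*]\|<\epsilon$ for all $k\ge K$ (Euclidean norm), when $\mathcal{A}$ is initialized at $\mathcal{X}^0$. Asymptotic convention (as $\epsilon\to0$): $g(\epsilon)=\tilde{\mathcal{O}}(R\ln(1/\epsilon))$ means that there is a universal constant $c'>0$ and some $\epsilon_0\in(0,1)$,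 which may depend on the algorithm, the quadratic function and the initialization points, such that $g(\epsilon)\le c'R\ln(1/\epsilon)$ for all $\epsilon\in(0,\epsilon_0)$. *)

theory Defs
  imports
    "HOL-Probability.Probability"
    "Jordan_Normal_Form.Spectral_Radius"
    "Jordan_Normal_Form.Gauss_Jordan_Elimination"
begin

unbundle no vec_syntax
no_notation inner (infixl \<open>\<bullet>\<close> 70)

section \<open>Quadratic functions\<close>

text \<open>
  Vectors and matrices have explicit dimensions (\<^typ>\<open>real vec\<close>, \<^typ>\<open>real mat\<close>), so that a
  constant can be quantified outside of the dimension \<open>d\<close>.
\<close>

definition sym_mats :: "nat \<Rightarrow> real set \<Rightarrow> real mat set" where
  "sym_mats d \<Sigma> = {A \<in> carrier_mat d d. transpose_mat A = A \<and> spectrum A \<subseteq> \<Sigma>}"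

definition quad_fun :: "real mat \<Rightarrow> real vec \<Rightarrow> real vec \<Rightarrow> real" where
  "quad_fun A b x = 1 / 2 * (x \<bullet> (A *\<^sub>v x)) + b \<bullet> x"

definition minimizer :: "nat \<Rightarrow> (real vec \<Rightarrow> real) \<Rightarrow> real vec" where
  "minimizer d f = arg_min_on f (carrier_vec d)"

definition euclid_norm :: "real vec \<Rightarrow> real" where
  "euclid_norm v = sqrt (v \<bullet> v)"

definition expect_vec :: "nat \<Rightarrow> 'w measure \<Rightarrow> ('w \<Rightarrow> real vec) \<Rightarrow> real vec" where
  "expect_vec d M F = vec d (\<lambda>i. \<integral>\<omega>. F \<omega> $ i \<partial>M)"

definition expect_mat :: "nat \<Rightarrow> 'w measure \<Rightarrow> ('w \<Rightarrow> real mat) \<Rightarrow> real mat" where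
  "expect_mat d M F = mat d d (\<lambda>(r, c). \<integral>\<omega>. F \<omega> $$ (r, c) \<partial>M)"

section \<open>\<open>p\<close>-SCLI algorithms\<close>

text \<open>
  A draw of the tuple of random matrices \<open>(C\<^sub>0(X), \<dots>, C\<^bsub>p-1\<^esub>(X), N(X))\<close> is encoded by its
  entries: the coordinate \<open>(j, r, c)\<close> is the entry \<open>(r, c)\<close> of \<open>C\<^sub>j(X)\<close> if \<open>j < p\<close>, and of \<open>N(X)\<close>
  if \<open>j = p\<close>. An algorithm maps each matrix \<open>X\<close> to the joint law of this tuple; the matrices within
  one draw may be dependent.
\<close>

type_synonym draw = "nat \<times> nat \<times> nat \<Rightarrow> real"
type_synonym scli = "real mat \<Rightarrow> draw measure"

definition coeff_mat :: "nat \<Rightarrow> nat \<Rightarrow> draw \<Rightarrow> real mat" where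
  "coeff_mat d j \<omega> = mat d d (\<lambda>(r, c). \<omega> (j, r, c))"

definition inversion_mat :: "nat \<Rightarrow> nat \<Rightarrow> draw \<Rightarrow> real mat" where
  "inversion_mat p d \<omega> = mat d d (\<lambda>(r, c). \<omega> (p, r, c))"

definition draw_space :: "nat \<Rightarrow> nat \<Rightarrow> draw measure" where
  "draw_space p d = (\<Pi>\<^sub>M i \<in> {..p} \<times> {..<d} \<times> {..<d}. borel)"

definition simultaneously_triangularizable :: "nat \<Rightarrow> real mat set \<Rightarrow> bool" where
  "simultaneously_triangularizable d S \<longleftrightarrow>
     (\<exists>Q \<in> carrier_mat d d. \<exists>Q' \<in> carrier_mat d d. Q * Q' = 1\<^sub>m d \<and> Q' * Q = 1\<^sub>m d \<and>
        (\<forall>B \<in> S. upper_triangular (Q' * B * Q)))"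

definition is_scli :: "nat \<Rightarrow> nat \<Rightarrow> scli \<Rightarrow> bool" where
  "is_scli p d \<A> \<longleftrightarrow>
     (\<forall>X \<in> carrier_mat d d.
        prob_space (\<A> X) \<and> sets (\<A> X) = sets (draw_space p d) \<and>
        (\<forall>i \<in> {..p} \<times> {..<d} \<times> {..<d}. integrable (\<A> X) (\<lambda>\<omega>. \<omega> i)) \<and>
        simultaneously_triangularizable d
          ((\<lambda>j. expect_mat d (\<A> X) (coeff_mat d j)) ` {..<p}))"

definition scalar_inversion :: "nat \<Rightarrow> nat \<Rightarrow> scli \<Rightarrow> bool" where
  "scalar_inversion p d \<A> \<longleftrightarrow>
     (\<exists>\<nu>. \<forall>X \<in> carrier_mat d d. AE \<omega> in \<A> X. inversion_mat p d \<omega> = \<nu> \<cdot>\<^sub>m 1\<^sub>m d)"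

text \<open>
  Iterates for the right-hand side \<open>b\<close> and the initialization points \<open>X0 0, \<dots>, X0 (p - 1)\<close>;
  iteration \<open>k\<close> uses the draw \<open>\<omega> k\<close>. Under \<open>run_space\<close> the draws are independent with common law
  \<open>\<A> A\<close>. The matrix \<open>A\<close> enters only through that law.
\<close>

definition run_space :: "scli \<Rightarrow> real mat \<Rightarrow> (nat \<Rightarrow> draw) measure" where
  "run_space \<A> A = (\<Pi>\<^sub>M k \<in> UNIV. \<A> A)"

function iterate ::
  "nat \<Rightarrow> nat \<Rightarrow> real vec \<Rightarrow> (nat \<Rightarrow> real vec) \<Rightarrow> (nat \<Rightarrow> draw) \<Rightarrow> nat \<Rightarrow> real vec" where
  "iterate p d b X0 \<omega> k =
     (if k < p then X0 k
      else vec d (\<lambda>i. (\<Sum>j<p. (coeff_mat d j (\<omega> k) *\<^sub>v iterate p d b X0 \<omega> (k - p + j)) $ i)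
                      + (inversion_mat p d (\<omega> k) *\<^sub>v b) $ i))"
  by pat_completeness auto
termination
  by (relation "Wellfounded.measure (\<lambda>(p, d, b, X0, \<omega>, k). k)") auto

declare iterate.simps [simp del]

definition consistent_wrt :: "nat \<Rightarrow> nat \<Rightarrow> scli \<Rightarrow> real mat \<Rightarrow> bool" where
  "consistent_wrt p d \<A> A \<longleftrightarrow>
     (\<forall>b \<in> carrier_vec d. \<forall>X0 \<in> {..<p} \<rightarrow> carrier_vec d.
        (\<lambda>k. euclid_norm (expect_vec d (run_space \<A> A) (\<lambda>\<omega>. iterate p d b X0 \<omega> k)
               - (- (the (mat_inverse A) *\<^sub>v b)))) \<longlonglongrightarrow> 0)"

definition consistent :: "nat \<Rightarrow> nat \<Rightarrow> scli \<Rightarrow> real set \<Rightarrow> bool" where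
  "consistent p d \<A> \<Sigma> \<longleftrightarrow> (\<forall>A \<in> sym_mats d \<Sigma>. consistent_wrt p d \<A> A)"

text \<open>The infimum is \<open>\<infinity>\<close> if no suitable \<open>K\<close> exists.\<close>

definition iteration_complexity ::
  "nat \<Rightarrow> nat \<Rightarrow> scli \<Rightarrow> real \<Rightarrow> real mat \<Rightarrow> real vec \<Rightarrow> (nat \<Rightarrow> real vec) \<Rightarrow> enat" where
  "iteration_complexity p d \<A> \<epsilon> A b X0 =
     Inf {enat K | K. \<forall>k\<ge>K.
       euclid_norm (expect_vec d (run_space \<A> A)
         (\<lambda>\<omega>. iterate p d b X0 \<omega> k - minimizer d (quad_fun A b))) < \<epsilon>}"

text \<open>
  \<open>g(\<epsilon>) = O(R ln (1/\<epsilon>))\<close> for \<open>\<epsilon> \<rightarrow> 0\<close> with constant \<open>c\<close>. The constant is a parameter because it has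
  to be universal, whereas the threshold may depend on everything else.
\<close>

definition log_bound :: "real \<Rightarrow> (real \<Rightarrow> enat) \<Rightarrow> real \<Rightarrow> bool" where
  "log_bound c g R \<longleftrightarrow>
     (\<exists>\<epsilon>\<^sub>0 \<in> {0<..<1}. \<forall>\<epsilon> \<in> {0<..<\<epsilon>\<^sub>0}. ereal_of_enat (g \<epsilon>) \<le> ereal (c * R * ln (1 / \<epsilon>)))"

end

theory Submission
  imports Defs
begin

text \<open>
  The algorithm is deterministic with \<open>N = - I / L\<close>. For \<open>A = U diag(e\<^sub>i) U\<^sup>T\<close> put
  \<open>r\<^sub>i = 1 - (e\<^sub>i / L) powr (1 / p)\<close>, and let \<open>C\<^sub>j(A)\<close> be diagonal in the same basis, its entries
  being the coefficients of \<open>z\<^sup>j\<close> in \<open>z\<^sup>p - (z - r\<^sub>i)\<^sup>p\<close>. Since \<open>(1 - r\<^sub>i)\<^sup>p = e\<^sub>i / L\<close>, the point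
  \<open>- A\<^sup>-\<^sup>1 b\<close> is a fixed point, and the error in the \<open>i\<close>-th eigendirection satisfies a recurrence
  whose characteristic polynomial \<open>(z - r\<^sub>i)\<^sup>p\<close> has the only root \<open>r\<^sub>i \<le> 1 - 1 / R\<close>, where
  \<open>R = root p (L / \<mu>)\<close>. Hence the error is \<open>O(s\<^sup>k)\<close> for \<open>s = 1 - 1 / (2 R)\<close>: the gap between \<open>r\<^sub>i\<close> and
  \<open>s\<close> absorbs the polynomial factor that the multiplicity of the root produces.
\<close>

section \<open>Linear recurrences with a single characteristic root\<close>

text \<open>The operator \<open>E - r\<close> on sequences, with \<open>E\<close> the shift. Its
  \<open>p\<close>-th power vanishes on a sequence exactly when the sequence obeys the linear
  recurrence with characteristic polynomial \<open>(z - r) ^ p\<close>.\<close>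

definition shift_diff :: "real \<Rightarrow> (nat \<Rightarrow> real) \<Rightarrow> nat \<Rightarrow> real" where
  "shift_diff r u k = u (Suc k) - r * u k"

text \<open>Shift and scalar multiplication commute, so \<open>(E - r) ^ p\<close> expands by the
  binomial theorem; the induction step is Pascal's rule.\<close>

lemma shift_diff_funpow:
  fixes r :: real and u :: "nat \<Rightarrow> real"
  shows "(shift_diff r ^^ p) u k = (\<Sum>j\<le>p. (p choose j) * (- r) ^ (p - j) * u (k + j))"
proof (induction p arbitrary: k)
  case 0
  show ?case by simp
next
  case (Suc p)
  let ?t = "\<lambda>j. real (p choose j) * (- r) ^ (p - j) * u (k + Suc j)"
  \<comment> \<open>Both sums are extended to \<open>j \<le> Suc p\<close> so that Pascal's rule
    applies term by term: here the new term at \<open>j = 0\<close> is set to zero, in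
    \<open>scaled\<close> the one at \<open>j = Suc p\<close> vanishes because
    \<open>p choose Suc p = 0\<close>.\<close>
  have shifted: "(\<Sum>j\<le>p. ?t j) =
    (\<Sum>j\<le>Suc p. (if j = 0 then 0 else real (p choose (j - 1)) * (- r) ^ (Suc p - j) * u (k + j)))"
    by (subst sum.atMost_Suc_shift) simp
  have scaled: "(\<Sum>j\<le>p. - r * (real (p choose j) * (- r) ^ (p - j) * u (k + j))) =
    (\<Sum>j\<le>Suc p. real (p choose j) * (- r) ^ (Suc p - j) * u (k + j))"
    by (simp add: Suc_diff_le binomial_eq_0 ac_simps)
  have "(shift_diff r ^^ Suc p) u k =
      (\<Sum>j\<le>p. ?t j) + (\<Sum>j\<le>p. - r * (real (p choose j) * (- r) ^ (p - j) * u (k + j)))"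
    by (simp add: shift_diff_def Suc.IH sum_distrib_left sum_negf)
  also have "\<dots> = (\<Sum>j\<le>Suc p. (Suc p choose j) * (- r) ^ (Suc p - j) * u (k + j))"
    unfolding shifted scaled sum.distrib [symmetric]
    by (intro sum.cong refl) (auto simp: algebra_simps gr0_conv_Suc split: nat.split)
  finally show ?case .
qed

text \<open>Inverts one factor \<open>E - r\<close>: a forcing term of order \<open>s ^ k\<close>
  produces a solution of the same order because \<open>r < s\<close> strictly. For
  \<open>r = s\<close> a factor \<open>k\<close> could appear.\<close>

lemma geometric_bound_shift_diff:
  assumes "0 \<le> r" "r < s" and K: "\<And>k. \<bar>shift_diff r u k\<bar> \<le> K * s ^ k"
  shows "\<exists>K'. \<forall>k. \<bar>u k\<bar> \<le> K' * s ^ k"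
proof -
  \<comment> \<open>The first argument settles \<open>k = 0\<close>; the second gives
    \<open>r * K' + K \<le> s * K'\<close>, which carries the induction.\<close>
  define K' where "K' = max \<bar>u 0\<bar> (K / (s - r))"
  have "K \<le> (s - r) * K'"
    using assms(2) max.cobounded2[of "K / (s - r)" "\<bar>u 0\<bar>", folded K'_def]
    by (simp add: pos_divide_le_eq mult.commute)
  have "\<bar>u k\<bar> \<le> K' * s ^ k" for k
  proof (induction k)
    case 0
    show ?case by (simp add: K'_def)
  next
    case (Suc k)
    have "\<bar>u (Suc k)\<bar> \<le> r * \<bar>u k\<bar> + \<bar>shift_diff r u k\<bar>"
      using assms(1) abs_triangle_ineq[of "r * u k" "shift_diff r u k"]
      by (simp add: shift_diff_def abs_mult)
    also have "\<dots> \<le> r * (K' * s ^ k) + (s - r) * K' * s ^ k"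
      using Suc assms \<open>K \<le> (s - r) * K'\<close>
      by (intro add_mono mult_left_mono order_trans[OF K] mult_right_mono) auto
    finally show ?case by (simp add: algebra_simps)
  qed
  then show ?thesis by blast
qed

lemma geometric_bound_shift_diff_funpow:
  assumes "0 \<le> r" "r < s" "\<And>k. (shift_diff r ^^ p) u k = 0"
  shows "\<exists>K. \<forall>k. \<bar>u k\<bar> \<le> K * s ^ k"
  using assms(3)
proof (induction p arbitrary: u)
  case 0
  then show ?case by (intro exI[of _ 0]) simp
next
  case (Suc p)
  \<comment> \<open>The innermost factor is split off, so the induction hypothesis applies to the
    sequence \<open>shift_diff r u\<close> in place of \<open>u\<close>.\<close>
  then have "\<exists>K. \<forall>k. \<bar>shift_diff r u k\<bar> \<le> K * s ^ k"
    by (simp add: funpow_Suc_right del: funpow.simps)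
  then show ?case
    using geometric_bound_shift_diff[OF assms(1,2)] by blast
qed

text \<open>The coefficients of \<open>z ^ p - (z - r) ^ p\<close>.\<close>

definition root_coeff :: "nat \<Rightarrow> real \<Rightarrow> nat \<Rightarrow> real" where
  "root_coeff p r j = - (real (p choose j) * (- r) ^ (p - j))"

text \<open>The polynomial \<open>z ^ p - (z - r) ^ p\<close> evaluated at
  \<open>z = 1\<close>.\<close>

lemma sum_root_coeff: "(\<Sum>j<p. root_coeff p r j) = 1 - (1 - r) ^ p"
proof -
  have "(1 - r) ^ p = (\<Sum>j\<le>p. real (p choose j) * (- r) ^ (p - j))"
    using binomial_ring[of 1 "- r" p] by simp
  also have "\<dots> = 1 - (\<Sum>j<p. root_coeff p r j)"
    by (simp add: lessThan_Suc_atMost [symmetric] root_coeff_def sum_negf)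
  finally show ?thesis by simp
qed

text \<open>By \<open>sum_root_coeff\<close> the inhomogeneity is the one for which the constant
  sequence \<xi> is a solution. Hence \<open>z - \<xi>\<close> solves the homogeneous recurrence and
  is annihilated by \<open>(E - r) ^ p\<close>.\<close>

lemma root_coeff_recurrence_converges:
  fixes z :: "nat \<Rightarrow> real"
  assumes r: "0 \<le> r" "r < s"
    and rec: "\<And>k. z (k + p) = (\<Sum>j<p. root_coeff p r j * z (k + j)) + (1 - r) ^ p * \<xi>"
  shows "\<exists>K. \<forall>k. \<bar>z k - \<xi>\<bar> \<le> K * s ^ k"
proof (rule geometric_bound_shift_diff_funpow[OF r])
  fix k
  have "(shift_diff r ^^ p) (\<lambda>k. z k - \<xi>) k =
      z (k + p) - \<xi> - (\<Sum>j<p. root_coeff p r j * (z (k + j) - \<xi>))"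
    by (simp add: shift_diff_funpow lessThan_Suc_atMost [symmetric] root_coeff_def sum_negf)
  also have "\<dots> = z (k + p) - \<xi> - (\<Sum>j<p. root_coeff p r j * z (k + j))
      + (\<Sum>j<p. root_coeff p r j) * \<xi>"
    by (simp add: right_diff_distrib sum_subtractf sum_distrib_right)
  also have "\<dots> = 0"
    by (simp add: rec sum_root_coeff algebra_simps)
  finally show "(shift_diff r ^^ p) (\<lambda>k. z k - \<xi>) k = 0" .
qed

section \<open>The spectral theorem for real symmetric matrices\<close>

lemma scalar_prod_self_eq_0_iff:
  fixes v :: "real vec" assumes "v \<in> carrier_vec n" 
  shows "v \<bullet> v = 0 \<longleftrightarrow> v = 0\<^sub>v n"
  using conjugate_square_eq_0_vec[OF assms] by (simp add: conjugate_vec_def)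

text \<open>A complex eigenvector \<open>w = x + i y\<close> exists in any positive dimension.
  Symmetry forces its eigenvalue \<open>c\<close> to be real, and then whichever of
  \<open>x\<close>, \<open>y\<close> is nonzero is a real eigenvector.\<close>

lemma symmetric_mat_has_eigenvector:
  fixes A :: "real mat"
  assumes A: "A \<in> carrier_mat n n" and sym: "transpose_mat A = A" and "0 < n"
  shows "\<exists>v a. v \<in> carrier_vec n \<and> v \<noteq> 0\<^sub>v n \<and> A *\<^sub>v v = a \<cdot>\<^sub>v v"
proof -
  let ?Ac = "map_mat complex_of_real A"
  have "?Ac \<in> carrier_mat n n" using A by simp
  with spectrum_non_empty[OF this \<open>0 < n\<close>] obtain c w
    where w: "w \<in> carrier_vec n" "w \<noteq> 0\<^sub>v n" and ev: "?Ac *\<^sub>v w = c \<cdot>\<^sub>v w"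
    by (auto simp: spectrum_def eigenvalue_def eigenvector_def)
  define x where "x = map_vec Re w"
  define y where "y = map_vec Im w"
  have xy: "x \<in> carrier_vec n" "y \<in> carrier_vec n" using w by (auto simp: x_def y_def)
  have comp: "(\<Sum>j<n. complex_of_real (A $$ (i, j)) * w $ j) = c * w $ i" if "i < n" for i
    using arg_cong[OF ev, of "\<lambda>v. v $ i"] that A w
    by (simp add: scalar_prod_def lessThan_atLeast0)
  \<comment> \<open>Real and imaginary parts of \<open>A w = c w\<close>. Inserted into
    \<open>x \<bullet> A y = A x \<bullet> y\<close> they leave \<open>Im c\<close> times the
    squared length of \<open>w\<close>.\<close>
  have Ax: "A *\<^sub>v x = Re c \<cdot>\<^sub>v x - Im c \<cdot>\<^sub>v y"
    using A w arg_cong[OF comp, of _ Re]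
    by (intro eq_vecI) (auto simp: x_def y_def scalar_prod_def lessThan_atLeast0)
  have Ay: "A *\<^sub>v y = Im c \<cdot>\<^sub>v x + Re c \<cdot>\<^sub>v y"
    using A w arg_cong[OF comp, of _ Im]
    by (intro eq_vecI) (auto simp: x_def y_def scalar_prod_def lessThan_atLeast0 algebra_simps)
  have "x \<bullet> (A *\<^sub>v y) = (A *\<^sub>v x) \<bullet> y"
    using transpose_vec_mult_scalar[OF A xy(2,1)] sym by simp
  then have "Im c * (x \<bullet> x + y \<bullet> y) = 0"
    using xy unfolding Ax Ay
    by (simp add: scalar_prod_add_distrib[of _ n] minus_scalar_prod_distrib[of _ n] algebra_simps)
  moreover have "x \<noteq> 0\<^sub>v n \<or> y \<noteq> 0\<^sub>v n"
  proof (rule ccontr)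
    assume "\<not> ?thesis"
    then have "x = 0\<^sub>v n" "y = 0\<^sub>v n" by auto
    then have "x $ i = 0" "y $ i = 0" if "i < n" for i using that by auto
    then have "w $ i = 0" if "i < n" for i
      using that w by (auto simp: x_def y_def complex_eq_iff)
    then show False using w by (auto intro: eq_vecI)
  qed
  moreover have "x \<bullet> x \<ge> 0" "y \<bullet> y \<ge> 0"
    by (auto simp: scalar_prod_def intro!: sum_nonneg)
  ultimately have "Im c = 0"
    using scalar_prod_self_eq_0_iff xy by (smt (verit) mult_eq_0_iff)
  then have "A *\<^sub>v x = Re c \<cdot>\<^sub>v x" "A *\<^sub>v y = Re c \<cdot>\<^sub>v y"
    using Ax Ay xy by auto
  with \<open>x \<noteq> 0\<^sub>v n \<or> y \<noteq> 0\<^sub>v n\<close> xy show ?thesis by blast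
qed

text \<open>Complete \<open>v\<close> to a basis, apply Gram-Schmidt, which keeps the first vector,
  and normalize.\<close>

lemma orthogonal_mat_with_first_col:
  fixes v :: "real vec"
  assumes v: "v \<in> carrier_vec n" "v \<noteq> 0\<^sub>v n"
  shows "\<exists>U \<in> carrier_mat n n. transpose_mat U * U = 1\<^sub>m n \<and> (\<exists>a. col U 0 = a \<cdot>\<^sub>v v)"
proof -
  interpret cof_vec_space n "TYPE(real)" .
  define b where "b = basis_completion v"
  note b = basis_completion[OF v, folded b_def]
  define ws where "ws = gram_schmidt n b"
  note gs = gram_schmidt_result[OF b(2,4,5) ws_def]
  have n: "0 < n" using v by (cases n) auto
  with b obtain bs where "b = v # bs" by (cases b) auto
  then have hd: "hd ws = v" using gram_schmidt_hd[OF v(1)] by (simp add: ws_def)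
  have len: "length ws = n" using gs b by simp
  have ws: "ws ! i \<in> carrier_vec n" if "i < n" for i using gs(3) len that by auto
  define us where "us = map (\<lambda>w. (1 / sqrt (w \<bullet> w)) \<cdot>\<^sub>v w) ws"
  define U where "U = mat_of_cols n us"
  have U: "U \<in> carrier_mat n n" by (auto simp: U_def us_def len)
  have colU: "col U i = (1 / sqrt (ws ! i \<bullet> ws ! i)) \<cdot>\<^sub>v ws ! i" if "i < n" for i
    using that len ws[OF that] by (simp add: U_def us_def)
  have "transpose_mat U * U = 1\<^sub>m n"
  proof (rule eq_matI)
    fix i j assume "i < dim_row (1\<^sub>m n :: real mat)" "j < dim_col (1\<^sub>m n :: real mat)"
    then have ij: "i < n" "j < n" by auto
    \<comment> \<open>Besides orthogonality, the case \<open>i = j\<close> says that no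
      \<open>ws ! i\<close> has length zero, so the normalization is legitimate.\<close>
    have "(ws ! i \<bullet> ws ! j = 0) = (i \<noteq> j)"
      using corthogonalD[OF gs(2)] ij len by (simp add: conjugate_vec_def)
    moreover have "ws ! i \<bullet> ws ! i \<ge> 0"
      by (auto simp: scalar_prod_def intro!: sum_nonneg)
    ultimately show "(transpose_mat U * U) $$ (i, j) = 1\<^sub>m n $$ (i, j)"
      using ij U ws[OF ij(1)] ws[OF ij(2)] by (auto simp: colU)
  qed (use U in auto)
  moreover have "col U 0 = (1 / sqrt (v \<bullet> v)) \<cdot>\<^sub>v v"
    using colU[OF n] hd len n by (cases ws) auto
  ultimately show ?thesis using U by blast
qed

text \<open>Deflation: in an orthonormal basis that starts with an eigenvector the matrix splits
  into a 1 by 1 block and a symmetric block of dimension one less.\<close>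

theorem spectral_theorem_real:
  fixes A :: "real mat"
  assumes "A \<in> carrier_mat n n" and "transpose_mat A = A"
  shows "\<exists>U \<in> carrier_mat n n. transpose_mat U * U = 1\<^sub>m n \<and>
    diagonal_mat (transpose_mat U * A * U)"
  using assms
proof (induction n arbitrary: A)
  case 0
  then show ?case by (intro bexI[of _ "1\<^sub>m 0"]) (auto simp: diagonal_mat_def)
next
  case (Suc n)
  note A = \<open>A \<in> carrier_mat (Suc n) (Suc n)\<close> and sym = \<open>transpose_mat A = A\<close>
  obtain v a where v: "v \<in> carrier_vec (Suc n)" "v \<noteq> 0\<^sub>v (Suc n)" "A *\<^sub>v v = a \<cdot>\<^sub>v v"
    using symmetric_mat_has_eigenvector[OF A sym] by auto
  obtain U b where U: "U \<in> carrier_mat (Suc n) (Suc n)" "transpose_mat U * U = 1\<^sub>m (Suc n)"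
    and col: "col U 0 = b \<cdot>\<^sub>v v"
    using orthogonal_mat_with_first_col[OF v(1,2)] by auto
  define B where "B = transpose_mat U * A * U"
  have B: "B \<in> carrier_mat (Suc n) (Suc n)" using U A by (simp add: B_def)
  have symB: "transpose_mat B = B"
    using U(1) A sym by (simp add: B_def transpose_mult[of _ "Suc n" "Suc n" _ "Suc n"] assoc_mult_mat[of _ "Suc n" "Suc n" _ "Suc n" _ "Suc n"])
  have "A *\<^sub>v col U 0 = a \<cdot>\<^sub>v col U 0"
    using v A by (simp add: col mult_mat_vec[OF A] smult_smult_assoc mult.commute)
  then have "col (A * U) 0 = a \<cdot>\<^sub>v col U 0"
    using U A col_mult2[OF A U(1), of 0] by simp
  have col0: "B $$ (i, 0) = (if i = 0 then a else 0)" if "i < Suc n" for i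
  proof -
    have "B $$ (i, 0) = (transpose_mat U * (A * U)) $$ (i, 0)"
      using U A by (simp add: B_def assoc_mult_mat[of _ "Suc n" "Suc n" _ "Suc n" _ "Suc n"])
    also have "\<dots> = col U i \<bullet> (a \<cdot>\<^sub>v col U 0)"
      using U A that \<open>col (A * U) 0 = _\<close> by simp
    also have "\<dots> = a * (transpose_mat U * U) $$ (i, 0)"
      using U(1) that by simp
    finally show ?thesis using U that by simp
  qed
  \<comment> \<open>The first column is \<open>a\<close> times the first unit vector because the
    basis starts with an eigenvector; symmetry transfers this to the first row.\<close>
  have row0: "B $$ (0, i) = (if i = 0 then a else 0)" if "i < Suc n" for i
    using col0[OF that] arg_cong[OF symB, of "\<lambda>M. M $$ (0, i)"] B that by auto
  define B' where "B' = mat n n (\<lambda>(i, j). B $$ (Suc i, Suc j))"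
  have "transpose_mat B' = B'"
  proof (rule eq_matI)
    fix i j assume "i < dim_row B'" "j < dim_col B'"
    then show "transpose_mat B' $$ (i, j) = B' $$ (i, j)"
      using arg_cong[OF symB, of "\<lambda>M. M $$ (Suc i, Suc j)"] B by (auto simp: B'_def)
  qed (auto simp: B'_def)
  moreover have B': "B' \<in> carrier_mat n n" by (simp add: B'_def)
  ultimately obtain V where V: "V \<in> carrier_mat n n" "transpose_mat V * V = 1\<^sub>m n"
    and diag: "diagonal_mat (transpose_mat V * B' * V)"
    using Suc.IH by blast
  let ?a = "mat 1 1 (\<lambda>_. a)"
  let ?blk = "\<lambda>X Y. four_block_mat X (0\<^sub>m 1 n) (0\<^sub>m n 1) Y"
  have Bblk: "B = ?blk ?a B'"
    using B col0 row0 by (intro eq_matI) (auto simp: B'_def)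
  \<comment> \<open>The diagonalizing matrix \<open>V\<close> of the smaller block, extended by the
    identity on the eigenvector; \<open>U * W\<close> then diagonalizes \<open>A\<close>.\<close>
  define W where "W = ?blk (1\<^sub>m 1) V"
  have W: "W \<in> carrier_mat (Suc n) (Suc n)" using V(1) by (auto simp: W_def)
  have WT: "transpose_mat W = ?blk (1\<^sub>m 1) (transpose_mat V)"
    unfolding W_def using V(1) by (subst transpose_four_block_mat) auto
  have "transpose_mat W * W = 1\<^sub>m (Suc n)"
    unfolding WT unfolding W_def using V
    by (subst mult_four_block_mat[of _ 1 1 _ n _ n _ _ 1 _ n]) auto
  have "transpose_mat W * B * W = ?blk ?a (transpose_mat V * B' * V)"
    unfolding WT Bblk unfolding W_def using V(1) B'
    by (simp add: mult_four_block_mat[of _ 1 1 _ n _ n _ _ 1 _ n])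
  then have "diagonal_mat (transpose_mat W * B * W)"
    using diag V(1) B' by (auto simp: diagonal_mat_def)
  moreover have "transpose_mat (U * W) * A * (U * W) = transpose_mat W * B * W"
    using U(1) W A by (simp add: B_def transpose_mult[of _ "Suc n" "Suc n" _ "Suc n"] assoc_mult_mat[of _ "Suc n" "Suc n" _ "Suc n" _ "Suc n"])
  moreover have "transpose_mat (U * W) * (U * W) = 1\<^sub>m (Suc n)"
  proof -
    have "transpose_mat (U * W) * (U * W) = transpose_mat W * ((transpose_mat U * U) * W)"
      using U(1) W by (simp add: transpose_mult[of _ "Suc n" "Suc n" _ "Suc n"] assoc_mult_mat[of _ "Suc n" "Suc n" _ "Suc n" _ "Suc n"])
    then show ?thesis using U W \<open>transpose_mat W * W = _\<close> by simp
  qed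
  ultimately show ?case using U(1) W by (intro bexI[of _ "U * W"]) auto
qed

section \<open>Expected iterates of a deterministic algorithm\<close>
text \<open>Points of a finite product of Borel spaces are measurable. This makes the event that a
  draw equals its deterministic value available for almost-sure statements.\<close>

lemma sets_singleton_draw_space:
  assumes "\<omega> \<in> space (draw_space p d)"
  shows "{\<omega>} \<in> sets (draw_space p d)"
proof -
  have "\<omega> \<in> extensional ({..p} \<times> {..<d} \<times> {..<d})"
    using assms by (simp add: draw_space_def space_PiM PiE_def)
  then have "{\<omega>} = (\<Pi>\<^sub>E i \<in> {..p} \<times> {..<d} \<times> {..<d}. {\<omega> i})"
    by (simp add: PiE_singleton)
  also have "\<dots> \<in> sets (draw_space p d)"
    unfolding draw_space_def by (intro sets_PiM_I_finite) auto
  finally show ?thesis .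
qed

text \<open>Each entry of an iterate is a polynomial in finitely many coordinates of the draws, by
  strong induction on \<open>k\<close>.\<close>

lemma iterate_measurable:
  assumes sets: "sets M = sets (draw_space p d)"
    and X0: "X0 \<in> {..<p} \<rightarrow> carrier_vec d" and b: "b \<in> carrier_vec d"
  shows "iterate p d b X0 \<omega> k \<in> carrier_vec d"
    and "i < d \<Longrightarrow> (\<lambda>\<omega>. iterate p d b X0 \<omega> k $ i) \<in> borel_measurable (\<Pi>\<^sub>M k \<in> UNIV. M)"
proof -
  show carrier: "iterate p d b X0 \<omega> k \<in> carrier_vec d" for \<omega> k
    using X0 by (subst iterate.simps) auto
  have entry [measurable]: "(\<lambda>\<omega>. \<omega> k (j, r, c)) \<in> borel_measurable (\<Pi>\<^sub>M k \<in> UNIV. M)"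
    if "j \<le> p" "r < d" "c < d" for k :: nat and j r c
  proof (rule measurable_compose[of "\<lambda>\<omega>. \<omega> k" _ M])
    have "(\<lambda>\<omega>. \<omega> (j, r, c)) \<in> borel_measurable (draw_space p d)"
      unfolding draw_space_def using that by (intro measurable_component_singleton) auto
    then show "(\<lambda>\<omega>. \<omega> (j, r, c)) \<in> borel_measurable M"
      using measurable_cong_sets[OF sets refl] by blast
  qed simp
  show "(\<lambda>\<omega>. iterate p d b X0 \<omega> k $ i) \<in> borel_measurable (\<Pi>\<^sub>M k \<in> UNIV. M)" if "i < d"
    using that
  proof (induction k arbitrary: i rule: less_induct)
    case (less k)
    show ?case
    proof (cases "k < p")
      case True
      then show ?thesis by (simp add: iterate.simps)
    next
      case False
      have "(\<lambda>\<omega>. (coeff_mat d j (\<omega> k) *\<^sub>v iterate p d b X0 \<omega> (k - p + j)) $ i)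
          \<in> borel_measurable (\<Pi>\<^sub>M k \<in> UNIV. M)" if "j < p" for j
      proof -
        have eq: "(coeff_mat d j (\<omega> k) *\<^sub>v iterate p d b X0 \<omega> (k - p + j)) $ i =
            (\<Sum>c<d. \<omega> k (j, i, c) * iterate p d b X0 \<omega> (k - p + j) $ c)" for \<omega>
          using carrier[of \<omega> "k - p + j"] \<open>i < d\<close>
          by (auto simp: coeff_mat_def scalar_prod_def lessThan_atLeast0 intro!: sum.cong)
        have [measurable]: "(\<lambda>\<omega>. iterate p d b X0 \<omega> (k - p + j) $ c)
            \<in> borel_measurable (\<Pi>\<^sub>M k \<in> UNIV. M)" if "c < d" for c
          using that False \<open>j < p\<close> by (intro less.IH) auto
        show ?thesis unfolding eq
          using that \<open>i < d\<close> by (intro borel_measurable_sum borel_measurable_times) auto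
      qed
      moreover have "(\<lambda>\<omega>. (inversion_mat p d (\<omega> k) *\<^sub>v b) $ i)
          \<in> borel_measurable (\<Pi>\<^sub>M k \<in> UNIV. M)"
      proof -
        have eq: "(inversion_mat p d (\<omega> k) *\<^sub>v b) $ i = (\<Sum>c<d. \<omega> k (p, i, c) * b $ c)" for \<omega> :: "nat \<Rightarrow> draw"
          using b \<open>i < d\<close>
          by (auto simp: inversion_mat_def scalar_prod_def lessThan_atLeast0 intro!: sum.cong)
        show ?thesis unfolding eq
          using \<open>i < d\<close> by (intro borel_measurable_sum borel_measurable_times) auto
      qed
      ultimately show ?thesis
        using False \<open>i < d\<close> by (subst iterate.simps) (auto intro!: borel_measurable_add borel_measurable_sum)
    qed
  qed
qed

text \<open>Under a product of Dirac measures the sequence of draws is almost surely constant, so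
  the expected iterate is the iterate along that constant sequence.\<close>

lemma expect_vec_run_deterministic:
  assumes A: "\<A> A = return (draw_space p d) \<omega>0" and \<omega>0: "\<omega>0 \<in> space (draw_space p d)"
    and X0: "X0 \<in> {..<p} \<rightarrow> carrier_vec d" and b: "b \<in> carrier_vec d"
  shows "expect_vec d (run_space \<A> A) (\<lambda>\<omega>. iterate p d b X0 \<omega> k) =
      iterate p d b X0 (\<lambda>_. \<omega>0) k"
    and "v \<in> carrier_vec d \<Longrightarrow>
      expect_vec d (run_space \<A> A) (\<lambda>\<omega>. iterate p d b X0 \<omega> k - v) =
      iterate p d b X0 (\<lambda>_. \<omega>0) k - v"
proof -
  let ?M = "return (draw_space p d) \<omega>0"
  let ?P = "\<Pi>\<^sub>M k \<in> (UNIV :: nat set). ?M"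
  interpret M: prob_space ?M by (rule prob_space_return[OF \<omega>0])
  interpret product_prob_space "\<lambda>_. ?M" "UNIV :: nat set" ..
  interpret P: prob_space ?P by (intro prob_space_PiM M.prob_space_axioms)
  have sets: "sets ?M = sets (draw_space p d)" by simp
  note meas = iterate_measurable[OF sets X0 b]
  have "AE \<omega> in ?P. \<omega> k = \<omega>0" for k
  proof -
    have "AE x in ?M. x = \<omega>0"
      using \<omega>0 sets_singleton_draw_space[OF \<omega>0]
      by (subst AE_return) (auto simp: pred_def Collect_conv_if)
    then have "AE x in distr ?P ?M (\<lambda>\<omega>. \<omega> k). x = \<omega>0"
      by (subst PiM_component) auto
    then show ?thesis
      by (rule AE_distrD[rotated]) (rule measurable_component_singleton, simp)
  qed
  \<comment> \<open>Only countably many draws occur, so the separate null sets combine to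
    one.\<close>
  then have AE: "AE \<omega> in ?P. \<omega> = (\<lambda>_. \<omega>0)"
    by (simp add: fun_eq_iff AE_all_countable)
  \<comment> \<open>The offset \<open>e\<close> serves both claims: it is \<open>0\<close> in the
    first and an entry of \<open>v\<close> in the second.\<close>
  have int: "(\<integral>\<omega>. iterate p d b X0 \<omega> k $ i - e \<partial>?P) = iterate p d b X0 (\<lambda>_. \<omega>0) k $ i - e"
    if "i < d" for i e
  proof -
    have "(\<integral>\<omega>. iterate p d b X0 \<omega> k $ i - e \<partial>?P) =
        (\<integral>\<omega>. iterate p d b X0 (\<lambda>_. \<omega>0) k $ i - e \<partial>?P)"
      using meas(2)[OF that] AE by (intro integral_cong_AE) auto
    then show ?thesis by (simp add: P.prob_space)
  qed
  note dim = carrier_vecD[OF meas(1)]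
  show "expect_vec d (run_space \<A> A) (\<lambda>\<omega>. iterate p d b X0 \<omega> k) =
      iterate p d b X0 (\<lambda>_. \<omega>0) k"
    using int[of _ 0] by (intro eq_vecI) (auto simp: expect_vec_def run_space_def A dim)
  show "expect_vec d (run_space \<A> A) (\<lambda>\<omega>. iterate p d b X0 \<omega> k - v) =
      iterate p d b X0 (\<lambda>_. \<omega>0) k - v" if v: "v \<in> carrier_vec d"
    using int v by (intro eq_vecI) (auto simp: expect_vec_def run_space_def A dim)
qed

section \<open>Orthogonal diagonalization and quadratic functions\<close>

text \<open>The basis \<open>U\<close> and the eigenvalues \<open>e\<close> are explicit arguments
  so that several matrices can be said to share one eigenbasis.\<close>

definition orthogonal_diagonalization :: "nat \<Rightarrow> real mat \<Rightarrow> real mat \<Rightarrow> (nat \<Rightarrow> real) \<Rightarrow> bool" where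
  "orthogonal_diagonalization d A U e \<longleftrightarrow> U \<in> carrier_mat d d \<and>
     transpose_mat U * U = 1\<^sub>m d \<and> U * transpose_mat U = 1\<^sub>m d \<and>
     A = U * mat d d (\<lambda>(i, j). if i = j then e i else 0) * transpose_mat U"

lemma mult_mat_vec_cancel:
  fixes U V :: "real mat"
  assumes "U \<in> carrier_mat d d" "V \<in> carrier_mat d d" "U * V = 1\<^sub>m d" "v \<in> carrier_vec d"
  shows "U *\<^sub>v (V *\<^sub>v v) = v"
  using assms(3) assoc_mult_mat_vec[OF assms(1,2,4)] one_mult_mat_vec[OF assms(4)] by metis

text \<open>In the coordinates \<open>U^T v\<close> the matrix acts entrywise; this decouples the
  iteration into scalar recurrences.\<close>

lemma orthogonal_diagonalization_mult:
  assumes "orthogonal_diagonalization d A U e" and v: "v \<in> carrier_vec d" and i: "i < d"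
  shows "(transpose_mat U *\<^sub>v (A *\<^sub>v v)) $ i = e i * (transpose_mat U *\<^sub>v v) $ i"
proof -
  let ?D = "mat d d (\<lambda>(i, j). if i = j then e i else 0)"
  have U: "U \<in> carrier_mat d d" "transpose_mat U * U = 1\<^sub>m d" 
    and A: "A = U * ?D * transpose_mat U"
    using assms by (auto simp: orthogonal_diagonalization_def)
  let ?w = "transpose_mat U *\<^sub>v v"
  have w: "?w \<in> carrier_vec d" using U(1) v by (intro mult_mat_vec_carrier[of _ d d]) auto
  have "A *\<^sub>v v = U *\<^sub>v (?D *\<^sub>v ?w)"
    using U(1) v w assoc_mult_mat_vec[of "U * ?D" d d "transpose_mat U" d v]
      assoc_mult_mat_vec[of U d d ?D d ?w] by (simp add: A)
  then have "transpose_mat U *\<^sub>v (A *\<^sub>v v) = ?D *\<^sub>v ?w"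
    using U w by (simp add: mult_mat_vec_cancel[of _ d] mult_mat_vec_carrier[of _ d d])
  also have "\<dots> $ i = (\<Sum>j<d. (if i = j then e i else 0) * (transpose_mat U *\<^sub>v v) $ j)"
    using i U(1) by (auto simp: scalar_prod_def lessThan_atLeast0 intro!: sum.cong)
  also have "\<dots> = e i * (transpose_mat U *\<^sub>v v) $ i"
    using i by (simp add: if_distrib[of "\<lambda>x. x * _"] cong: if_cong)
  finally show ?thesis .
qed

lemma euclid_norm_transpose_orthogonal:
  assumes U: "U \<in> carrier_mat d d" "U * transpose_mat U = 1\<^sub>m d" and v: "v \<in> carrier_vec d"
  shows "euclid_norm (transpose_mat U *\<^sub>v v) = euclid_norm v"
proof -
  have "(transpose_mat U *\<^sub>v v) \<bullet> (transpose_mat U *\<^sub>v v) = v \<bullet> (U *\<^sub>v (transpose_mat U *\<^sub>v v))"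
    using U v by (intro transpose_vec_mult_scalar[of _ d d]) auto
  also have "U *\<^sub>v (transpose_mat U *\<^sub>v v) = v"
    using U v by (intro mult_mat_vec_cancel[of _ d]) auto
  finally show ?thesis by (simp add: euclid_norm_def)
qed

lemma euclid_norm_le_sum:
  assumes "v \<in> carrier_vec d"
  shows "euclid_norm v \<le> (\<Sum>i<d. \<bar>v $ i\<bar>)"
proof -
  have "euclid_norm v = L2_set (\<lambda>i. v $ i) {..<d}"
    using assms by (auto simp: euclid_norm_def L2_set_def scalar_prod_def power2_eq_square lessThan_atLeast0)
  then show ?thesis using L2_set_le_sum_abs by metis
qed

text \<open>With \<open>w = U^T v\<close> the form becomes a sum of the terms \<open>e i\<close>
  times the square of \<open>w $ i\<close>, and \<open>w\<close> is nonzero because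
  \<open>U w = v\<close>.\<close>

lemma quad_form_positive:
  assumes diag: "orthogonal_diagonalization d A U e" and pos: "\<And>i. i < d \<Longrightarrow> 0 < e i"
    and v: "v \<in> carrier_vec d" "v \<noteq> 0\<^sub>v d"
  shows "0 < v \<bullet> (A *\<^sub>v v)"
proof -
  have U: "U \<in> carrier_mat d d" "U * transpose_mat U = 1\<^sub>m d" and A: "A \<in> carrier_mat d d"
    using diag by (auto simp: orthogonal_diagonalization_def)
  define w where "w = transpose_mat U *\<^sub>v v"
  have w: "w \<in> carrier_vec d" using U(1) v(1) by (simp add: w_def)
  have inv: "U *\<^sub>v w = v"
    using U v(1) by (simp add: w_def mult_mat_vec_cancel[of _ d])
  have "v \<bullet> (A *\<^sub>v v) = (A *\<^sub>v v) \<bullet> (U *\<^sub>v w)"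
    using A v(1) by (simp add: inv comm_scalar_prod[of _ d])
  also have "\<dots> = (transpose_mat U *\<^sub>v (A *\<^sub>v v)) \<bullet> w"
    using transpose_vec_mult_scalar[OF U(1) w, of "A *\<^sub>v v"] A v(1) by simp
  also have "\<dots> = (\<Sum>i<d. e i * (w $ i)\<^sup>2)"
    using w U(1) orthogonal_diagonalization_mult[OF diag v(1)]
    by (auto simp: scalar_prod_def w_def power2_eq_square lessThan_atLeast0 mult.assoc
      simp del: index_mult_mat_vec)
  finally have eq: "v \<bullet> (A *\<^sub>v v) = (\<Sum>i<d. e i * (w $ i)\<^sup>2)" .
  have "w \<noteq> 0\<^sub>v d" using inv v U(1) by auto
  then obtain i where "i < d" "w $ i \<noteq> 0"
    using w by (metis eq_vecI carrier_vecD index_zero_vec)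
  then show ?thesis
    unfolding eq using pos by (intro sum_pos2[of _ i]) (auto intro!: mult_nonneg_nonneg simp: less_imp_le)
qed

text \<open>At \<open>x + h\<close> the terms linear in \<open>h\<close> cancel because
  \<open>A x = - b\<close>, which leaves the positive excess
  \<open>1 / 2 * (h \<bullet> A h)\<close>. Strictness gives uniqueness, which pins down the choice
  operator behind \<open>minimizer\<close>.\<close>

lemma minimizer_quad_fun:
  assumes A: "A \<in> carrier_mat d d" "transpose_mat A = A"
    and pos: "\<And>v. v \<in> carrier_vec d \<Longrightarrow> v \<noteq> 0\<^sub>v d \<Longrightarrow> 0 < v \<bullet> (A *\<^sub>v v)"
    and x: "x \<in> carrier_vec d" "A *\<^sub>v x = - b" and b: "b \<in> carrier_vec d"
  shows "minimizer d (quad_fun A b) = x"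
proof -
  have less: "quad_fun A b x < quad_fun A b y" if y: "y \<in> carrier_vec d" "y \<noteq> x" for y
  proof -
    define h where "h = y - x"
    have h: "h \<in> carrier_vec d" using x y by (simp add: h_def)
    have yx: "y = x + h" using x(1) y(1) by (intro eq_vecI) (auto simp: h_def)
    then have "h \<noteq> 0\<^sub>v d" using y x(1) by auto
    have "x \<bullet> (A *\<^sub>v h) = h \<bullet> (A *\<^sub>v x)"
      using transpose_vec_mult_scalar[OF A(1) h x(1)] A x(1) h
        comm_scalar_prod[of "A *\<^sub>v x" d h] by simp
    moreover have "h \<bullet> (A *\<^sub>v x) = - (b \<bullet> h)"
      using h b comm_scalar_prod[of h d "- b"] by (simp add: x(2))
    moreover have "y \<bullet> (A *\<^sub>v y) = x \<bullet> (A *\<^sub>v x) + x \<bullet> (A *\<^sub>v h) + h \<bullet> (A *\<^sub>v x) + h \<bullet> (A *\<^sub>v h)"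
      using A x(1) h by (simp add: yx mult_add_distrib_mat_vec[of _ d d]
        scalar_prod_add_distrib[of _ d] add_scalar_prod_distrib[of _ d])
    moreover have "b \<bullet> y = b \<bullet> x + b \<bullet> h"
      using b x(1) h by (simp add: yx scalar_prod_add_distrib[of _ d])
    ultimately have "quad_fun A b y = quad_fun A b x + 1 / 2 * (h \<bullet> (A *\<^sub>v h))"
      by (simp add: quad_fun_def algebra_simps)
    with pos[OF h \<open>h \<noteq> 0\<^sub>v d\<close>] show ?thesis by simp
  qed
  show ?thesis
    unfolding minimizer_def arg_min_on_def arg_min_def is_arg_min_def
  proof (rule some_equality)
    show "x \<in> carrier_vec d \<and> \<not> (\<exists>y. y \<in> carrier_vec d \<and> quad_fun A b y < quad_fun A b x)"
      using x(1) less by (metis less_asym)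
  qed (use x(1) less in metis)
qed

section \<open>From geometric decay of the error to iteration complexity\<close>

lemma log_bound_geometric:
  assumes "0 < R" "s \<le> 1 - 1 / (2 * R)" "0 \<le> s"
    and bound: "\<And>k. euclid_norm (expect_vec d (run_space \<A> A)
         (\<lambda>\<omega>. iterate p d b X0 \<omega> k - minimizer d (quad_fun A b))) \<le> K * s ^ k"
    and "1 \<le> R"
  shows "log_bound 4 (\<lambda>\<epsilon>. iteration_complexity p d \<A> \<epsilon> A b X0) R"
proof -
  \<comment> \<open>Raising the constant to at least 1 makes \<open>ln G\<close> defined and
    nonnegative.\<close>
  define G where "G = max K 1"
  \<comment> \<open>Below this threshold \<open>ln (1 / \<epsilon>)\<close> exceeds
    \<open>ln G + 1\<close>, so it absorbs the contribution of \<open>K\<close> and the rounding.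
    The threshold may depend on the function and the initialization, the factor 4 may not.\<close>
  define E where "E = exp (- (ln G + 1))"
  have G: "0 < G" "K \<le> G" "0 \<le> ln G" by (auto simp: G_def)
  have "- (ln G + 1) < 0" using G(3) by linarith
  then have "E \<in> {0<..<1}" by (simp add: E_def)
  moreover have "ereal_of_enat (iteration_complexity p d \<A> \<epsilon> A b X0) \<le> ereal (4 * R * ln (1 / \<epsilon>))"
    if \<epsilon>: "\<epsilon> \<in> {0<..<E}" for \<epsilon>
  proof -
    define l where "l = ln (1 / \<epsilon>)"
    have "ln \<epsilon> < ln E" using \<epsilon> by (subst ln_less_cancel_iff) (auto intro: less_trans)
    then have l: "ln G + 1 < l" using \<epsilon> by (simp add: l_def ln_div E_def)
    \<comment> \<open>The first integer strictly above \<open>2 * R * (ln G + l)\<close>; strictness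
      yields an error strictly below \<epsilon>. The added 1 is later bounded by
      \<open>2 * R\<close>.\<close>
    define N where "N = nat \<lfloor>2 * R * (ln G + l)\<rfloor> + 1"
    have "K * s ^ k < \<epsilon>" if "N \<le> k" for k
    proof -
      have k: "2 * R * (ln G + l) < k" using that unfolding N_def by linarith
      then have kR: "ln G + l < k / (2 * R)"
        using assms(1) by (simp add: pos_less_divide_eq mult.commute)
      \<comment> \<open>From \<open>1 + x \<le> exp x\<close> at
        \<open>x = - 1 / (2 * R)\<close>.\<close>
      have "s \<le> exp (- 1 / (2 * R))"
        using assms(2) exp_ge_add_one_self[of "- 1 / (2 * R)"] by simp
      then have "s ^ k \<le> exp (- 1 / (2 * R)) ^ k" using assms by (intro power_mono) auto
      also have "\<dots> = exp (- (k / (2 * R)))" by (simp flip: exp_of_nat_mult)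
      also have "\<dots> < exp (- (ln G + l))" using kR by simp
      also have "\<dots> = \<epsilon> / G"
        using \<epsilon> G by (simp add: l_def ln_div exp_diff exp_minus field_simps)
      finally have "G * s ^ k < \<epsilon>" using G by (simp add: pos_less_divide_eq mult.commute)
      moreover have "K * s ^ k \<le> G * s ^ k" using G assms by (intro mult_right_mono) auto
      ultimately show ?thesis by simp
    qed
    then have "iteration_complexity p d \<A> \<epsilon> A b X0 \<le> enat N"
      unfolding iteration_complexity_def using bound
      by (intro Inf_lower) (auto intro: le_less_trans)
    then have "ereal_of_enat (iteration_complexity p d \<A> \<epsilon> A b X0) \<le> ereal_of_enat (enat N)"
      by (simp only: ereal_of_enat_le_iff)
    also have "\<dots> = ereal (real N)" by simp
    also have "\<dots> \<le> ereal (4 * R * l)"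
    proof -
      have "real N \<le> 2 * R * (ln G + l) + 1" 
        using l G(3) assms(1) of_nat_floor[of "2 * R * (ln G + l)"] by (simp add: N_def)
      also have "\<dots> \<le> 2 * R * (ln G + l) + 2 * R" using assms by simp
      also have "\<dots> = 2 * R * (ln G + 1 + l)" by (simp add: algebra_simps)
      also have "\<dots> \<le> 2 * R * (2 * l)" using l assms by (intro mult_left_mono) auto
      finally show ?thesis by simp
    qed
    finally show ?thesis by (simp add: l_def)
  qed
  ultimately show ?thesis unfolding log_bound_def by blast
qed

section \<open>Diagonalization of the matrices and decay of the error\<close>

lemma orthogonal_diagonalization_exists:
  assumes "A \<in> sym_mats d \<Sigma>"
  shows "\<exists>U e. orthogonal_diagonalization d A U e \<and> (\<forall>i<d. e i \<in> \<Sigma>)"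
proof -
  have A: "A \<in> carrier_mat d d" "transpose_mat A = A" and spec: "spectrum A \<subseteq> \<Sigma>"
    using assms by (auto simp: sym_mats_def)
  obtain U where U: "U \<in> carrier_mat d d" "transpose_mat U * U = 1\<^sub>m d"
    and diag: "diagonal_mat (transpose_mat U * A * U)"
    using spectral_theorem_real[OF A] by blast
  have UU: "U * transpose_mat U = 1\<^sub>m d"
    using mat_mult_left_right_inverse[of "transpose_mat U" d U] U by simp
  define e where "e = (\<lambda>i. (transpose_mat U * A * U) $$ (i, i))"
  have D: "mat d d (\<lambda>(i, j). if i = j then e i else 0) = transpose_mat U * A * U"
    using diag U(1) A(1) by (intro eq_matI) (auto simp: diagonal_mat_def e_def)
  have "U * (transpose_mat U * A * U) * transpose_mat U
      = (U * transpose_mat U) * A * (U * transpose_mat U)"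
    using U(1) A(1) by (simp add: assoc_mult_mat[of _ d d _ d _ d])
  then have eq: "A = U * mat d d (\<lambda>(i, j). if i = j then e i else 0) * transpose_mat U"
    unfolding D UU using A(1) by simp
  have od: "orthogonal_diagonalization d A U e"
    unfolding orthogonal_diagonalization_def using U UU eq by blast
  have "e i \<in> \<Sigma>" if i: "i < d" for i
  proof -
    \<comment> \<open>Column \<open>i\<close> of \<open>U\<close>, shown to be an eigenvector for
      \<open>e i\<close>; this places \<open>e i\<close> in the spectrum and hence in
      \<Sigma>.\<close>
    let ?v = "U *\<^sub>v unit_vec d i"
    have v: "?v \<in> carrier_vec d" using U(1) by (intro mult_mat_vec_carrier[of _ d d]) auto
    have Uv: "transpose_mat U *\<^sub>v ?v = unit_vec d i"
      using U by (intro mult_mat_vec_cancel) auto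
    have "transpose_mat U *\<^sub>v (A *\<^sub>v ?v) = e i \<cdot>\<^sub>v unit_vec d i"
    proof (rule eq_vecI)
      fix j assume "j < dim_vec (e i \<cdot>\<^sub>v unit_vec d i)"
      then have j: "j < d" by simp
      show "(transpose_mat U *\<^sub>v (A *\<^sub>v ?v)) $ j = (e i \<cdot>\<^sub>v unit_vec d i) $ j"
        unfolding orthogonal_diagonalization_mult[OF od v j] Uv using i j by (auto simp: unit_vec_def)
    qed (use U(1) in simp)
    then have "U *\<^sub>v (transpose_mat U *\<^sub>v (A *\<^sub>v ?v)) = e i \<cdot>\<^sub>v ?v"
      using U(1) by (simp add: mult_mat_vec[of _ d d])
    moreover have "U *\<^sub>v (transpose_mat U *\<^sub>v (A *\<^sub>v ?v)) = A *\<^sub>v ?v"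
      using U(1) UU A(1) v by (intro mult_mat_vec_cancel[of _ d] mult_mat_vec_carrier[of _ d d]) auto
    ultimately have "A *\<^sub>v ?v = e i \<cdot>\<^sub>v ?v" by simp
    moreover have "?v \<noteq> 0\<^sub>v d"
    proof
      assume "?v = 0\<^sub>v d"
      then have "unit_vec d i $ i = (transpose_mat U *\<^sub>v 0\<^sub>v d) $ i" using Uv by simp
      then show False using i U(1) by simp
    qed
    ultimately have "e i \<in> spectrum A"
      using A(1) v by (auto simp: spectrum_def eigenvalue_def eigenvector_def)
    with spec show ?thesis by blast
  qed
  with od show ?thesis by blast
qed

lemma orthogonal_diagonalization_triangularizes:
  assumes "U \<in> carrier_mat d d" "transpose_mat U * U = 1\<^sub>m d" "U * transpose_mat U = 1\<^sub>m d"
    and "\<And>B. B \<in> S \<Longrightarrow> \<exists>e. orthogonal_diagonalization d B U e"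
  shows "simultaneously_triangularizable d S"
  unfolding simultaneously_triangularizable_def
proof (rule bexI[of _ U], rule bexI[of _ "transpose_mat U"], intro conjI ballI)
  fix B assume "B \<in> S"
  then obtain e where "orthogonal_diagonalization d B U e" using assms(4) by blast
  moreover define D where "D = mat d d (\<lambda>(i, j). if i = j then e i else 0)"
  ultimately have B: "B = U * D * transpose_mat U" and D: "D \<in> carrier_mat d d"
    by (auto simp: orthogonal_diagonalization_def)
  have "transpose_mat U * B * U = (transpose_mat U * U) * D * (transpose_mat U * U)"
    unfolding B using assms(1) D by (simp add: assoc_mult_mat[of _ d d _ d _ d])
  also have "\<dots> = D" unfolding assms(2) using D by simp
  finally show "upper_triangular (transpose_mat U * B * U)"
    by (simp add: upper_triangular_def D_def)
qed (use assms in auto)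

text \<open>In the shared eigenbasis each coordinate of \<open>y\<close> follows a scalar recurrence
  with the single root \<open>r i\<close>. As \<open>b = - A x\<close>, its inhomogeneity is
  \<open>- \<nu> * e i\<close> times the coordinate of \<open>x\<close>, and the assumption on
  \<open>r i\<close> makes that coordinate the fixed point.\<close>

lemma scli_error_geometric:
  assumes A: "orthogonal_diagonalization d A U e"
    and C: "\<And>j. j < p \<Longrightarrow> orthogonal_diagonalization d (C j) U (\<lambda>i. root_coeff p (r i) j)"
    and r: "\<And>i. i < d \<Longrightarrow> 0 \<le> r i \<and> r i < s \<and> (1 - r i) ^ p = - \<nu> * e i"
    and x: "x \<in> carrier_vec d" "A *\<^sub>v x = - b" and b: "b \<in> carrier_vec d"
    and y: "\<And>k. y k \<in> carrier_vec d"
    and rec: "\<And>k l. l < d \<Longrightarrow> y (k + p) $ l = (\<Sum>j<p. (C j *\<^sub>v y (k + j)) $ l) + \<nu> * b $ l"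
  shows "\<exists>K. \<forall>k. euclid_norm (y k - x) \<le> K * s ^ k"
proof -
  have U: "U \<in> carrier_mat d d" "U * transpose_mat U = 1\<^sub>m d"
    using A by (auto simp: orthogonal_diagonalization_def)
  have UT: "(transpose_mat U *\<^sub>v w) $ i = (\<Sum>l<d. U $$ (l, i) * w $ l)"
    if "w \<in> carrier_vec d" "i < d" for w i
    using that U(1) by (auto simp: scalar_prod_def lessThan_atLeast0 intro!: sum.cong)
  have Cy: "C j *\<^sub>v y k \<in> carrier_vec d" if "j < p" for j k
    using C[OF that] y by (intro mult_mat_vec_carrier[of _ d d]) (auto simp: orthogonal_diagonalization_def)
  have "\<exists>K. \<forall>k. \<bar>(transpose_mat U *\<^sub>v y k) $ i - (transpose_mat U *\<^sub>v x) $ i\<bar> \<le> K * s ^ k"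
    if i: "i < d" for i
  proof (rule root_coeff_recurrence_converges)
    fix k
    have "(transpose_mat U *\<^sub>v y (k + p)) $ i =
        (\<Sum>l<d. \<Sum>j<p. U $$ (l, i) * (C j *\<^sub>v y (k + j)) $ l) + \<nu> * (\<Sum>l<d. U $$ (l, i) * b $ l)"
      using i y by (simp add: UT rec sum.distrib sum_distrib_left algebra_simps
        del: index_mult_mat_vec)
    also have "(\<Sum>l<d. \<Sum>j<p. U $$ (l, i) * (C j *\<^sub>v y (k + j)) $ l) =
        (\<Sum>j<p. (transpose_mat U *\<^sub>v (C j *\<^sub>v y (k + j))) $ i)"
      using i Cy by (subst sum.swap) (simp add: UT del: index_mult_mat_vec)
    also have "\<dots> = (\<Sum>j<p. root_coeff p (r i) j * (transpose_mat U *\<^sub>v y (k + j)) $ i)"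
      using orthogonal_diagonalization_mult[OF C y i] by (intro sum.cong) auto
    also have "(\<Sum>l<d. U $$ (l, i) * b $ l) = - (\<Sum>l<d. U $$ (l, i) * (A *\<^sub>v x) $ l)"
      using b by (simp add: x(2) sum_negf)
    also have "(\<Sum>l<d. U $$ (l, i) * (A *\<^sub>v x) $ l) = e i * (transpose_mat U *\<^sub>v x) $ i"
      using orthogonal_diagonalization_mult[OF A x(1) i] b i
      by (simp add: UT x(2) del: index_mult_mat_vec)
    finally show "(transpose_mat U *\<^sub>v y (k + p)) $ i =
        (\<Sum>j<p. root_coeff p (r i) j * (transpose_mat U *\<^sub>v y (k + j)) $ i)
        + (1 - r i) ^ p * (transpose_mat U *\<^sub>v x) $ i"
      using r[OF i] by simp
  qed (use r[OF i] in auto)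
  \<comment> \<open>The bound \<open>i < d\<close> is moved under the existential so that the
    constants can be chosen as a function of \<open>i\<close>; their sum over \<open>i\<close>
    bounds the norm.\<close>
  then have "\<forall>i. \<exists>K. i < d \<longrightarrow>
      (\<forall>k. \<bar>(transpose_mat U *\<^sub>v y k) $ i - (transpose_mat U *\<^sub>v x) $ i\<bar> \<le> K * s ^ k)"
    by blast
  then obtain K where K: "\<And>i k. i < d \<Longrightarrow>
      \<bar>(transpose_mat U *\<^sub>v y k) $ i - (transpose_mat U *\<^sub>v x) $ i\<bar> \<le> K i * s ^ k"
    using choice by metis
  have "euclid_norm (y k - x) \<le> (\<Sum>i<d. K i) * s ^ k" for k
  proof -
    have "euclid_norm (y k - x) = euclid_norm (transpose_mat U *\<^sub>v (y k - x))"
      using U y[of k] x(1) by (intro euclid_norm_transpose_orthogonal[symmetric]) auto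
    also have "\<dots> \<le> (\<Sum>i<d. \<bar>(transpose_mat U *\<^sub>v (y k - x)) $ i\<bar>)"
      using U(1) x(1) y[of k] by (intro euclid_norm_le_sum mult_mat_vec_carrier[of _ d d]) auto
    also have "\<dots> = (\<Sum>i<d. \<bar>(transpose_mat U *\<^sub>v y k) $ i - (transpose_mat U *\<^sub>v x) $ i\<bar>)"
      using U(1) x(1) y[of k]
      by (intro sum.cong refl) (simp add: mult_minus_distrib_mat_vec[of _ d d])
    also have "\<dots> \<le> (\<Sum>i<d. K i * s ^ k)" using K by (intro sum_mono) auto
    finally show ?thesis by (simp add: sum_distrib_right)
  qed
  then show ?thesis by blast
qed

text \<open>Injectivity makes the determinant nonzero, so \<open>mat_inverse\<close> returns a
  proper inverse and \<open>the\<close> is applied to a \<open>Some\<close>.\<close>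

lemma mat_inverse_solves:
  fixes A :: "real mat"
  assumes A: "A \<in> carrier_mat d d"
    and inj: "\<And>v. v \<in> carrier_vec d \<Longrightarrow> v \<noteq> 0\<^sub>v d \<Longrightarrow> A *\<^sub>v v \<noteq> 0\<^sub>v d"
    and b: "b \<in> carrier_vec d"
  shows "- (the (mat_inverse A) *\<^sub>v b) \<in> carrier_vec d"
    and "A *\<^sub>v - (the (mat_inverse A) *\<^sub>v b) = - b"
proof -
  have "det A \<noteq> 0" using inj det_0_iff_vec_prod_zero[OF A] by blast
  then have "mat_inverse A \<noteq> None"
    using mat_inverse(1)[OF A, of "()"] det_non_zero_imp_unit[OF A, of "()"] by blast
  then obtain B where B: "mat_inverse A = Some B" by blast
  note inv = mat_inverse(2)[OF A B]
  let ?w = "B *\<^sub>v b"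
  have w: "?w \<in> carrier_vec d" using inv b by (intro mult_mat_vec_carrier[of _ d d]) auto
  then show "- (the (mat_inverse A) *\<^sub>v b) \<in> carrier_vec d" by (simp add: B)
  have "A *\<^sub>v (- w) = - (A *\<^sub>v w)" if "w \<in> carrier_vec d" for w
    using A that by (intro eq_vecI) auto
  from this[OF w] have "A *\<^sub>v (- ?w) = - (A *\<^sub>v ?w)" .
  also have "A *\<^sub>v ?w = b"
    using A inv b by (intro mult_mat_vec_cancel[of _ d]) auto
  finally show "A *\<^sub>v - (the (mat_inverse A) *\<^sub>v b) = - b" by (simp add: B)
qed

text \<open>Writing the index as \<open>k + p\<close> removes the case distinction and the truncated
  subtraction, which gives the form that the scalar recurrences use.\<close>

lemma iterate_const_draw:
  assumes "\<And>j. j < p \<Longrightarrow> coeff_mat d j \<omega> = C j"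
    and "inversion_mat p d \<omega> = \<nu> \<cdot>\<^sub>m 1\<^sub>m d" and b: "b \<in> carrier_vec d" and "l < d"
  shows "iterate p d b X0 (\<lambda>_. \<omega>) (k + p) $ l =
    (\<Sum>j<p. (C j *\<^sub>v iterate p d b X0 (\<lambda>_. \<omega>) (k + j)) $ l) + \<nu> * b $ l"
proof -
  have "((\<nu> \<cdot>\<^sub>m 1\<^sub>m d) *\<^sub>v b) $ l = \<nu> * b $ l"
    using b \<open>l < d\<close> by (simp add: smult_scalar_prod_distrib[of _ d])
  then show ?thesis
    using assms by (subst iterate.simps) simp
qed

section \<open>The algorithm\<close>

theorem mainTheorem2:
  shows "\<exists>c>0. \<forall>(\<mu>::real) (L::real) (d::nat) (p::nat).
    0 < \<mu> \<and> \<mu> \<le> L \<and> 1 \<le> d \<and> 1 \<le> p \<longrightarrow>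
    (\<exists>\<A>::scli. is_scli p d \<A> \<and> consistent p d \<A> {\<mu>..L} \<and> scalar_inversion p d \<A> \<and>
       (\<forall>A \<in> sym_mats d {\<mu>..L}. \<forall>b \<in> carrier_vec d. \<forall>X0 \<in> {..<p} \<rightarrow> carrier_vec d.
          log_bound c (\<lambda>\<epsilon>. iteration_complexity p d \<A> \<epsilon> A b X0) (root p (L / \<mu>))))"
\<comment> \<open>The constant of \<open>log_bound_geometric\<close>, fixed before \<mu>,
  \<open>L\<close>, \<open>d\<close> and \<open>p\<close>.\<close>
proof (intro exI[of _ 4] conjI allI impI)
  fix \<mu> L :: real and d p :: nat
  assume "0 < \<mu> \<and> \<mu> \<le> L \<and> 1 \<le> d \<and> 1 \<le> p"
  then have \<mu>: "0 < \<mu>" "\<mu> \<le> L" "0 < L" and p: "0 < p" by auto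
  define R where "R = root p (L / \<mu>)"
  \<comment> \<open>The midpoint between \<open>1 - 1 / R\<close>, the largest possible root, and
    1.\<close>
  define s where "s = 1 - 1 / (2 * R)"
  define r where "r = (\<lambda>x. 1 - root p (x / L))"
  have R: "1 \<le> R" using \<mu> p by (simp add: R_def)
  have s: "0 \<le> s" "s < 1" using R by (auto simp: s_def)
  \<comment> \<open>Here \<open>x \<le> L\<close> gives \<open>0 \<le> r x\<close>, and
    \<open>\<mu> \<le> x\<close> gives \<open>r x \<le> 1 - 1 / R < s\<close>. The last conjunct is
    the fixed-point condition for \<nu> = \<open>- 1 / L\<close>.\<close>
  have r: "0 \<le> r x \<and> r x < s \<and> (1 - r x) ^ p = - (- 1 / L) * x" if "x \<in> {\<mu>..L}" for x
  proof -
    have "root p (\<mu> / L) \<le> root p (x / L)" "root p (x / L) \<le> 1"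
      using that \<mu> p by (auto simp: divide_right_mono)
    moreover have "root p (\<mu> / L) = 1 / R" by (simp add: R_def real_root_divide)
    moreover have "root p (x / L) ^ p = x / L"
      using that \<mu> p by (intro real_root_pow_pos2) auto
    moreover have "1 / (2 * R) < 1 / R" using R by (simp add: field_simps)
    ultimately show ?thesis by (auto simp: r_def s_def)
  qed
  \<comment> \<open>The eigenbasis is known only to exist, so the coefficient matrices are obtained
    by choice from this specification. Triangularizability is required for every \<open>X\<close>,
    since an algorithm must be defined on all matrices.\<close>
  define good where "good = (\<lambda>X C. (\<forall>j. C j \<in> carrier_mat d d) \<and>
      simultaneously_triangularizable d (C ` {..<p}) \<and>
      (X \<in> sym_mats d {\<mu>..L} \<longrightarrow> (\<exists>U e. orthogonal_diagonalization d X U e \<and>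
        (\<forall>i<d. e i \<in> {\<mu>..L}) \<and>
        (\<forall>j<p. orthogonal_diagonalization d (C j) U (\<lambda>i. root_coeff p (r (e i)) j)))))"
  have "\<exists>C. good X C" for X
  proof (cases "X \<in> sym_mats d {\<mu>..L}")
    case True
    then obtain U e where X: "orthogonal_diagonalization d X U e" "\<forall>i<d. e i \<in> {\<mu>..L}"
      using orthogonal_diagonalization_exists by blast
    define C where "C = (\<lambda>j. U * mat d d (\<lambda>(i, l). if i = l then root_coeff p (r (e i)) j else 0)
      * transpose_mat U)"
    have U: "U \<in> carrier_mat d d" "transpose_mat U * U = 1\<^sub>m d" "U * transpose_mat U = 1\<^sub>m d"
      using X(1) by (auto simp: orthogonal_diagonalization_def)
    have C: "orthogonal_diagonalization d (C j) U (\<lambda>i. root_coeff p (r (e i)) j)" for j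
      using U by (simp add: orthogonal_diagonalization_def C_def)
    have "C j \<in> carrier_mat d d" for j using U(1) unfolding C_def by (intro mult_carrier_mat[of _ d d]) auto
    moreover have "simultaneously_triangularizable d (C ` {..<p})"
      using C by (intro orthogonal_diagonalization_triangularizes[OF U]) auto
    ultimately show ?thesis
      unfolding good_def using X C by blast
  next
    case False
    \<comment> \<open>Zero matrices serve as default outside the class of interest.\<close>
    have "simultaneously_triangularizable d ((\<lambda>_. 0\<^sub>m d d) ` {..<p})"
      unfolding simultaneously_triangularizable_def
      by (intro bexI[of _ "1\<^sub>m d"]) (auto simp: upper_triangular_def)
    with False show ?thesis
      unfolding good_def by (intro exI[of _ "\<lambda>_. 0\<^sub>m d d"]) auto
  qed
  then obtain C where C: "\<And>X. good X (C X)" using choice by metis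
  have C_carrier: "C X j \<in> carrier_mat d d" for X j using C[of X] by (simp add: good_def)
  let ?I = "{..p} \<times> {..<d} \<times> {..<d}"
  \<comment> \<open>The one draw made for \<open>X\<close>, with the inversion matrix at index
    \<open>p\<close>. Restriction to the index set makes it a point of
    \<open>draw_space\<close>.\<close>
  define \<omega> :: "real mat \<Rightarrow> draw" where "\<omega> = (\<lambda>X. \<lambda>(j, i, l) \<in> ?I.
    if j = p then ((- 1 / L) \<cdot>\<^sub>m 1\<^sub>m d) $$ (i, l) else C X j $$ (i, l))"
  define \<A> :: scli where "\<A> = (\<lambda>X. return (draw_space p d) (\<omega> X))"
  have \<omega>: "\<omega> X \<in> space (draw_space p d)" for X
    by (simp add: \<omega>_def draw_space_def space_PiM)
  have Cmat: "coeff_mat d j (\<omega> X) = C X j" if "j < p" for j X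
    using that carrier_matD[OF C_carrier[of X j]]
    by (intro eq_matI) (auto simp: coeff_mat_def \<omega>_def)
  have Nmat: "inversion_mat p d (\<omega> X) = (- 1 / L) \<cdot>\<^sub>m 1\<^sub>m d" for X
    by (intro eq_matI) (auto simp: inversion_mat_def \<omega>_def)
  have prob: "prob_space (\<A> X)" for X
    unfolding \<A>_def by (rule prob_space_return[OF \<omega>])
  have coord: "(\<lambda>\<omega>. \<omega> i) \<in> borel_measurable (draw_space p d)" if "i \<in> ?I" for i
    unfolding draw_space_def using that by (rule measurable_component_singleton)
  have "is_scli p d \<A>"
    unfolding is_scli_def
  proof (intro ballI conjI)
    fix X :: "real mat"
    show "integrable (\<A> X) (\<lambda>\<omega>. \<omega> i)" if "i \<in> ?I" for i
      unfolding \<A>_def using coord[OF that] \<omega>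
      by (intro integrableI_bounded) (auto simp: nn_integral_return)
    have "expect_mat d (\<A> X) (coeff_mat d j) = C X j" if "j < p" for j
    proof -
      have "(\<integral>w. coeff_mat d j w $$ (i, l) \<partial>\<A> X) = C X j $$ (i, l)" if "i < d" "l < d" for i l
        using coord[of "(j, i, l)"] \<open>j < p\<close> that Cmat[OF \<open>j < p\<close>, of X, symmetric] \<omega>[of X]
        by (simp add: \<A>_def coeff_mat_def integral_return)
      then show ?thesis
        using carrier_matD[OF C_carrier[of X j]] by (intro eq_matI) (auto simp: expect_mat_def)
    qed
    then have "(\<lambda>j. expect_mat d (\<A> X) (coeff_mat d j)) ` {..<p} = C X ` {..<p}"
      by (intro image_cong) auto
    then show "simultaneously_triangularizable d
        ((\<lambda>j. expect_mat d (\<A> X) (coeff_mat d j)) ` {..<p})"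
      using C[of X] by (simp add: good_def)
  qed (use prob in \<open>auto simp: \<A>_def\<close>)
  moreover have "scalar_inversion p d \<A>"
    unfolding scalar_inversion_def
  proof (intro exI ballI)
    fix X :: "real mat"
    have "AE w in \<A> X. w = \<omega> X"
      unfolding \<A>_def using \<omega> sets_singleton_draw_space[OF \<omega>]
      by (subst AE_return) (auto simp: pred_def Collect_conv_if)
    then show "AE w in \<A> X. inversion_mat p d w = (- 1 / L) \<cdot>\<^sub>m 1\<^sub>m d"
      by eventually_elim (simp add: Nmat)
  qed
  \<comment> \<open>What consistency and complexity have in common: the minimizer is
    \<open>- A^(-1) b\<close>, and the deterministic iterates approach it geometrically.\<close>
  moreover have key: "minimizer d (quad_fun A b) = - (the (mat_inverse A) *\<^sub>v b) \<and>
      - (the (mat_inverse A) *\<^sub>v b) \<in> carrier_vec d \<and>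
      (\<exists>K. \<forall>k. euclid_norm (iterate p d b X0 (\<lambda>_. \<omega> A) k - - (the (mat_inverse A) *\<^sub>v b)) \<le> K * s ^ k)"
    if A: "A \<in> sym_mats d {\<mu>..L}" and b: "b \<in> carrier_vec d" and X0: "X0 \<in> {..<p} \<rightarrow> carrier_vec d"
    for A b X0
  proof -
    obtain U e where U: "orthogonal_diagonalization d A U e" "\<And>i. i < d \<Longrightarrow> e i \<in> {\<mu>..L}"
      "\<And>j. j < p \<Longrightarrow> orthogonal_diagonalization d (C A j) U (\<lambda>i. root_coeff p (r (e i)) j)"
      using C[of A] A unfolding good_def by blast
    have Ac: "A \<in> carrier_mat d d" "transpose_mat A = A" using A by (auto simp: sym_mats_def)
    have "0 < e i" if "i < d" for i using U(2)[OF that] \<mu> by auto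
    note pos = quad_form_positive[OF U(1) this]
    have "A *\<^sub>v v \<noteq> 0\<^sub>v d" if "v \<in> carrier_vec d" "v \<noteq> 0\<^sub>v d" for v
      using pos[OF _ that] that by auto
    note x = mat_inverse_solves[OF Ac(1) this b]
    have "minimizer d (quad_fun A b) = - (the (mat_inverse A) *\<^sub>v b)"
      using minimizer_quad_fun[OF Ac _ x b] pos by blast
    moreover have "\<exists>K. \<forall>k. euclid_norm (iterate p d b X0 (\<lambda>_. \<omega> A) k - - (the (mat_inverse A) *\<^sub>v b)) \<le> K * s ^ k"
    proof (rule scli_error_geometric[OF U(1,3) _ x b])
      show "iterate p d b X0 (\<lambda>_. \<omega> A) k \<in> carrier_vec d" for k
        using iterate_measurable(1)[OF refl X0 b] .
      show "iterate p d b X0 (\<lambda>_. \<omega> A) (k + p) $ l =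
          (\<Sum>j<p. (C A j *\<^sub>v iterate p d b X0 (\<lambda>_. \<omega> A) (k + j)) $ l) + (- 1 / L) * b $ l"
        if "l < d" for k l
        using iterate_const_draw[OF Cmat Nmat b that] by simp
    qed (use r U(2) in auto)
    ultimately show ?thesis using x(1) by blast
  qed
  moreover have "consistent p d \<A> {\<mu>..L}"
    unfolding consistent_def consistent_wrt_def
  proof (intro ballI)
    fix A :: "real mat" and b :: "real vec" and X0 :: "nat \<Rightarrow> real vec"
    assume A: "A \<in> sym_mats d {\<mu>..L}" and b: "b \<in> carrier_vec d" and X0: "X0 \<in> {..<p} \<rightarrow> carrier_vec d"
    let ?x = "- (the (mat_inverse A) *\<^sub>v b)"
    obtain K where K: "\<And>k. euclid_norm (iterate p d b X0 (\<lambda>_. \<omega> A) k - ?x) \<le> K * s ^ k"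
      using key[OF A b X0] by blast
    have lim: "(\<lambda>k. K * s ^ k) \<longlonglongrightarrow> 0"
      using tendsto_mult_right_zero[OF LIMSEQ_power_zero[of s]] s by simp
    have "norm (euclid_norm v) = euclid_norm v" for v
      by (simp add: euclid_norm_def scalar_prod_def sum_nonneg)
    then have "norm (euclid_norm (iterate p d b X0 (\<lambda>_. \<omega> A) k - ?x)) \<le> K * s ^ k" for k
      using K[of k] by simp
    then have conv: "(\<lambda>k. euclid_norm (iterate p d b X0 (\<lambda>_. \<omega> A) k - ?x)) \<longlonglongrightarrow> 0"
      by (rule Lim_null_comparison[OF eventuallyI lim])
    have "\<A> A = return (draw_space p d) (\<omega> A)" by (simp add: \<A>_def)
    note E = expect_vec_run_deterministic(1)[of \<A> A, OF this \<omega> X0 b]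
    show "(\<lambda>k. euclid_norm (expect_vec d (run_space \<A> A)
        (\<lambda>\<omega>. iterate p d b X0 \<omega> k) - ?x)) \<longlonglongrightarrow> 0"
      unfolding E by (rule conv)
  qed
  moreover have "log_bound 4 (\<lambda>\<epsilon>. iteration_complexity p d \<A> \<epsilon> A b X0) R"
    if A: "A \<in> sym_mats d {\<mu>..L}" and b: "b \<in> carrier_vec d" and X0: "X0 \<in> {..<p} \<rightarrow> carrier_vec d"
    for A b X0
  proof -
    obtain K where K: "\<And>k. euclid_norm (iterate p d b X0 (\<lambda>_. \<omega> A) k - minimizer d (quad_fun A b)) \<le> K * s ^ k"
      and x: "minimizer d (quad_fun A b) \<in> carrier_vec d"
      using key[OF A b X0] by metis
    have "\<A> A = return (draw_space p d) (\<omega> A)" by (simp add: \<A>_def)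
    note E = expect_vec_run_deterministic(2)[of \<A> A, OF this \<omega> X0 b x]
    show ?thesis
    proof (rule log_bound_geometric)
      show "euclid_norm (expect_vec d (run_space \<A> A)
          (\<lambda>\<omega>. iterate p d b X0 \<omega> k - minimizer d (quad_fun A b))) \<le> K * s ^ k" for k
        unfolding E by (rule K)
    qed (use R s in \<open>auto simp: s_def\<close>)
  qed
  ultimately show "\<exists>\<A>::scli. is_scli p d \<A> \<and> consistent p d \<A> {\<mu>..L} \<and> scalar_inversion p d \<A> \<and>
       (\<forall>A \<in> sym_mats d {\<mu>..L}. \<forall>b \<in> carrier_vec d. \<forall>X0 \<in> {..<p} \<rightarrow> carrier_vec d.
          log_bound 4 (\<lambda>\<epsilon>. iteration_complexity p d \<A> \<epsilon> A b X0) (root p (L / \<mu>)))"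
    unfolding R_def by blast
qed simp

end
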